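(* (Well-balance of the interpolation/remapping step.) Let $\mathcal V_h^{k,n}$ and $\mathcal V_h^{k,n+1}$ be the discontinuous piecewise polynomial spaces on the old and new meshes, and let $\mathrm{DGInterp},\ \mathrm{PP\text{-}DGInterp}:\mathcal V_h^{k,n}\to\mathcal V_h^{k,n+1}$ be transfer operators with the properties listed in the context. Given $h_h^n,m_h^n,w_h^n,\eta_h^n,b_h^n\in\mathcal V_h^{k,n}$, define $$\tilde h_h^n=\mathrm{PP\text{-}DGInterp}(h_h^n),\quad\tilde\eta_h^n=\mathrm{PP\text{-}DGInterp}(\eta_h^n),\quad\tilde m_h^n=\mathrm{DGInterp}(m_h^n),\quad\tilde w_h^n=\mathrm{DGInterp}(w_h^n),$$ $$b_h^{n+1}=\mathrm{DGInterp}(h_h^n+b_h^n)-\tilde h_h^n .$$ If, for some constants $C_1,C_2>0$, $$m_h^n=0,\qquad w_h^n=0,\qquad\eta_h^n=C_1h_h^n,\qquad h_h^n+b_h^n=C_2,$$ then $$\tilde m_h^n=0,\qquad\tilde w_h^n=0,\qquad\tilde\eta_h^n=C_1\tilde h_h^n,\qquad\tilde h_h^n+b_h^{n+1}=C_2 .$$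
   Context: $\mathcal T_h^n$ and $\mathcal T_h^{n+1}$ are two triangular meshes of the same domain $\Omega$ with the same number of elements and vertices and the same connectivity; for $\nu\in\{n,n+1\}$ and an integer $k\ge1$, $\mathcal V_h^{k,\nu}=\{q\in L^2(\Omega):q|_K\in\mathbb P^k(K)\ \forall K\in\mathcal T_h^\nu\}$, where $\mathbb P^k(K)$ is the set of polynomials of degree at most $k$ on $K$. $\mathrm{DGInterp}$ is the DG-interpolation operator obtained by discretizing the pseudo-time equation $\partial_\varsigma q=0$, $\varsigma\in(0,1]$, by a DG/Runge-Kutta method on the moving mesh interpolating linearly between $\mathcal T_h^n$ and $\mathcal T_h^{n+1}$; $\mathrm{PP\text{-}DGInterp}$ is the same scheme combined with a linear scaling positivity-preserving limiter. The properties used are: (i) $\mathrm{DGInterp}$ preserves constants: $\mathrm{DGInterp}(C)=C$ for every constant function $C$; (ii) $\mathrm{DGInterp}$ is linear; (iii) $\mathrm{PP\text{-}DGInterp}(Cq_h)=C\cdot\mathrm{PP\text{-}DGInterp}(q_h)$ for every constant $C\ge0$ and every $q_h\in\mathcal V_h^{k,n}$. The stated relations are the lake-at-rest steady state of the Ripa model, with $h$ the water depth, $m,w$ the momenta, $\eta$ the depth times temperature, and $b$ the bottom topography. *)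

theory Defs
  imports "HOL-Analysis.Analysis"
begin

text \<open>
  Elements of \<open>L\<^sup>2(\<Omega>)\<close> are represented by functions on the whole plane; two functions
  represent the same element iff they agree almost everywhere on \<open>\<Omega>\<close>.  Values outside
  \<open>\<Omega>\<close> are irrelevant.
\<close>

definition eq_on_dom :: "(real^2 \<Rightarrow> real) \<Rightarrow> (real^2) set \<Rightarrow> (real^2 \<Rightarrow> real) \<Rightarrow> bool"
    ("(_ \<doteq>\<^bsub>_\<^esub> _)" [51, 0, 51] 50) where
  "f \<doteq>\<^bsub>\<Omega>\<^esub> g \<longleftrightarrow> (AE x in lebesgue_on \<Omega>. f x = g x)"

definition L2 :: "(real^2) set \<Rightarrow> (real^2 \<Rightarrow> real) set" where
  "L2 \<Omega> = {q. q \<in> borel_measurable (lebesgue_on \<Omega>) \<and>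
               integrable (lebesgue_on \<Omega>) (\<lambda>x. (q x)\<^sup>2)}"

definition poly_le :: "nat \<Rightarrow> (real^2 \<Rightarrow> real) set" where
  "poly_le k = {p. \<exists>c :: nat \<Rightarrow> nat \<Rightarrow> real.
                    p = (\<lambda>x. \<Sum>i\<le>k. \<Sum>j\<le>k - i. c i j * (x $ 1) ^ i * (x $ 2) ^ j)}"

text \<open>
  A mesh is its set of closed elements.  The library's \<^const>\<open>triangulation\<close> supplies
  finiteness and conformity (two elements meet in a common, possibly empty, face).  The
  condition on the interiors is needed because \<open>closure \<Omega> - \<Omega>\<close> may have positive measure
  for a general open \<open>\<Omega>\<close>.
\<close>

definition triangular_mesh :: "(real^2) set \<Rightarrow> (real^2) set set \<Rightarrow> bool" where
  "triangular_mesh \<Omega> T \<longleftrightarrow>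
     triangulation T \<and> (\<forall>K\<in>T. 2 simplex K) \<and>
     \<Union>T = closure \<Omega> \<and> (\<forall>K\<in>T. interior K \<subseteq> \<Omega>)"

definition vertices :: "(real^2) set \<Rightarrow> (real^2) set" where
  "vertices K = {v. v extreme_point_of K}"

text \<open>
  Same connectivity: a bijection of the mesh vertices that carries the vertex triples of
  the elements of one mesh onto those of the other.  Equality of the numbers of vertices
  and of elements is part of this.
\<close>

definition same_connectivity :: "(real^2) set set \<Rightarrow> (real^2) set set \<Rightarrow> bool" where
  "same_connectivity T T' \<longleftrightarrow>
     (\<exists>\<phi>. bij_betw \<phi> (\<Union>K\<in>T. vertices K) (\<Union>K\<in>T'. vertices K) \<and>
          bij_betw (\<lambda>K. convex hull (\<phi> ` vertices K)) T T')"

definition DG_space :: "(real^2) set \<Rightarrow> nat \<Rightarrow> (real^2) set set \<Rightarrow> (real^2 \<Rightarrow> real) set" where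
  "DG_space \<Omega> k T = {q \<in> L2 \<Omega>. \<forall>K\<in>T. \<exists>p\<in>poly_le k. q \<doteq>\<^bsub>K\<^esub> p}"

text \<open>
  An operator between spaces of \<open>L\<^sup>2\<close> classes, given on representatives; the second
  conjunct says that it is well defined on classes.
\<close>

definition transfer_operator ::
    "(real^2) set \<Rightarrow> (real^2 \<Rightarrow> real) set \<Rightarrow> (real^2 \<Rightarrow> real) set \<Rightarrow>
     ((real^2 \<Rightarrow> real) \<Rightarrow> (real^2 \<Rightarrow> real)) \<Rightarrow> bool" where
  "transfer_operator \<Omega> V W D \<longleftrightarrow>
     (\<forall>q\<in>V. D q \<in> W) \<and>
     (\<forall>p\<in>V. \<forall>q\<in>V. p \<doteq>\<^bsub>\<Omega>\<^esub> q \<longrightarrow> D p \<doteq>\<^bsub>\<Omega>\<^esub> D q)"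

end

theory Submission
  imports Defs
begin

text \<open>
  Each conclusion is one of the operator properties, applied after the steady-state relation
  has been carried through the operator.  The only point that needs an argument is that the
  operators see an input through its class in \<open>L\<^sup>2(\<Omega>)\<close>, and only for representatives in the old
  space \<open>V\<close>: replacing \<open>m\<close> by \<open>0\<close>, \<open>\<eta>\<close> by \<open>C\<^sub>1 h\<close>, or \<open>h + b\<close> by \<open>C\<^sub>2\<close> under the operator requires
  \<open>0\<close>, \<open>C\<^sub>1 h\<close>, \<open>h + b\<close> and \<open>C\<^sub>2\<close> to lie in \<open>V\<close>.  So \<open>V\<close> is shown to be closed under addition and
  scaling (\<open>DG_space_add\<close>, \<open>DG_space_scale\<close>) and to contain the constants (\<open>DG_space_const\<close>).
  The last fact depends on the mesh: constants are square integrable because a domain that is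
  covered by finitely many triangles is bounded (\<open>triangular_mesh_bounded\<close>).

  The depth and the topography are remapped by different operators, but \<open>b'\<close> is defined by a
  difference, so that \<open>h' + b' = DGInterp (h + b)\<close> whatever \<open>h'\<close> is; constant preservation
  then gives \<open>C\<^sub>2\<close>.
\<close>

lemma eq_on_dom_sym: "f \<doteq>\<^bsub>\<Omega>\<^esub> g \<Longrightarrow> g \<doteq>\<^bsub>\<Omega>\<^esub> f"
  unfolding eq_on_dom_def by (auto elim: eventually_mono)

lemma eq_on_dom_trans [trans]: "f \<doteq>\<^bsub>\<Omega>\<^esub> g \<Longrightarrow> g \<doteq>\<^bsub>\<Omega>\<^esub> u \<Longrightarrow> f \<doteq>\<^bsub>\<Omega>\<^esub> u"
  unfolding eq_on_dom_def by (auto elim: eventually_elim2)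

lemma eq_on_dom_add:
  "f \<doteq>\<^bsub>\<Omega>\<^esub> f' \<Longrightarrow> g \<doteq>\<^bsub>\<Omega>\<^esub> g' \<Longrightarrow> (\<lambda>x. f x + g x) \<doteq>\<^bsub>\<Omega>\<^esub> (\<lambda>x. f' x + g' x)"
  unfolding eq_on_dom_def by (auto elim: eventually_elim2)

lemma eq_on_dom_scale: "f \<doteq>\<^bsub>\<Omega>\<^esub> g \<Longrightarrow> (\<lambda>x. c * f x) \<doteq>\<^bsub>\<Omega>\<^esub> (\<lambda>x. c * g x)"
  unfolding eq_on_dom_def by (auto elim: eventually_mono)

lemma L2_add:
  assumes "p \<in> L2 \<Omega>" "q \<in> L2 \<Omega>"
  shows "(\<lambda>x. p x + q x) \<in> L2 \<Omega>"
proof -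
  have [measurable]: "p \<in> borel_measurable (lebesgue_on \<Omega>)" "q \<in> borel_measurable (lebesgue_on \<Omega>)"
    and int: "integrable (lebesgue_on \<Omega>) (\<lambda>x. (p x)\<^sup>2)" "integrable (lebesgue_on \<Omega>) (\<lambda>x. (q x)\<^sup>2)"
    using assms by (auto simp: L2_def)
  have "integrable (lebesgue_on \<Omega>) (\<lambda>x. 2 * (p x)\<^sup>2 + 2 * (q x)\<^sup>2)"
    using int by simp
  then have "integrable (lebesgue_on \<Omega>) (\<lambda>x. (p x + q x)\<^sup>2)"
  proof (rule Bochner_Integration.integrable_bound)
    have "(a + c)\<^sup>2 \<le> 2 * a\<^sup>2 + 2 * c\<^sup>2" for a c :: real
      using zero_le_power2 [of "a - c"] by (simp add: power2_eq_square algebra_simps)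
    then show "AE x in lebesgue_on \<Omega>. norm ((p x + q x)\<^sup>2) \<le> norm (2 * (p x)\<^sup>2 + 2 * (q x)\<^sup>2)"
      by simp
  qed measurable
  then show ?thesis
    by (simp add: L2_def)
qed

lemma L2_scale: "q \<in> L2 \<Omega> \<Longrightarrow> (\<lambda>x. c * q x) \<in> L2 \<Omega>"
  by (auto simp: L2_def power_mult_distrib)

lemma L2_const:
  assumes "\<Omega> \<in> lmeasurable"
  shows "(\<lambda>_. C) \<in> L2 \<Omega>"
proof -
  interpret finite_measure "lebesgue_on \<Omega>"
    using assms by (rule finite_measure_lebesgue_on)
  show ?thesis
    by (simp add: L2_def)
qed

lemma poly_le_add:
  assumes "p \<in> poly_le k" "q \<in> poly_le k"
  shows "(\<lambda>x. p x + q x) \<in> poly_le k"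
proof -
  obtain c d where "p = (\<lambda>x. \<Sum>i\<le>k. \<Sum>j\<le>k - i. c i j * (x $ 1) ^ i * (x $ 2) ^ j)"
    and "q = (\<lambda>x. \<Sum>i\<le>k. \<Sum>j\<le>k - i. d i j * (x $ 1) ^ i * (x $ 2) ^ j)"
    using assms by (auto simp: poly_le_def)
  then have "(\<lambda>x. p x + q x) =
      (\<lambda>x. \<Sum>i\<le>k. \<Sum>j\<le>k - i. (c i j + d i j) * (x $ 1) ^ i * (x $ 2) ^ j)"
    by (simp add: sum.distrib distrib_right)
  then show ?thesis
    unfolding poly_le_def mem_Collect_eq by (rule exI [of _ "\<lambda>i j. c i j + d i j"])
qed

lemma poly_le_scale:
  assumes "p \<in> poly_le k"
  shows "(\<lambda>x. a * p x) \<in> poly_le k"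
proof -
  obtain c where "p = (\<lambda>x. \<Sum>i\<le>k. \<Sum>j\<le>k - i. c i j * (x $ 1) ^ i * (x $ 2) ^ j)"
    using assms by (auto simp: poly_le_def)
  then have "(\<lambda>x. a * p x) =
      (\<lambda>x. \<Sum>i\<le>k. \<Sum>j\<le>k - i. (a * c i j) * (x $ 1) ^ i * (x $ 2) ^ j)"
    by (simp add: sum_distrib_left mult.assoc)
  then show ?thesis
    unfolding poly_le_def mem_Collect_eq by (rule exI [of _ "\<lambda>i j. a * c i j"])
qed

lemma poly_le_const: "(\<lambda>_. C) \<in> poly_le k"
proof -
  define c :: "nat \<Rightarrow> nat \<Rightarrow> real" where "c = (\<lambda>i j. if i = 0 \<and> j = 0 then C else 0)"
  have "(\<Sum>i\<le>k. \<Sum>j\<le>k - i. c i j * (x $ 1) ^ i * (x $ 2) ^ j) = C" for x :: "real^2"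
  proof -
    have "(\<Sum>j\<le>k - i. c i j * (x $ 1) ^ i * (x $ 2) ^ j) = (if i = 0 then C else 0)" for i
    proof -
      have "(\<Sum>j\<le>k - i. c i j * (x $ 1) ^ i * (x $ 2) ^ j)
          = (\<Sum>j\<le>k - i. if j = 0 then (if i = 0 then C else 0) else 0)"
        by (rule sum.cong) (auto simp: c_def)
      then show ?thesis
        by simp
    qed
    then show ?thesis
      by simp
  qed
  then have "(\<lambda>_. C) = (\<lambda>x :: real^2. \<Sum>i\<le>k. \<Sum>j\<le>k - i. c i j * (x $ 1) ^ i * (x $ 2) ^ j)"
    by simp
  then show ?thesis
    unfolding poly_le_def by blast
qed

lemma DG_space_add:
  assumes "p \<in> DG_space \<Omega> k T" "q \<in> DG_space \<Omega> k T"
  shows "(\<lambda>x. p x + q x) \<in> DG_space \<Omega> k T"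
  unfolding DG_space_def mem_Collect_eq
proof (intro conjI ballI)
  show "(\<lambda>x. p x + q x) \<in> L2 \<Omega>"
    using assms by (intro L2_add) (simp_all add: DG_space_def)
next
  fix K assume "K \<in> T"
  then obtain p' q' where "p' \<in> poly_le k" "p \<doteq>\<^bsub>K\<^esub> p'" "q' \<in> poly_le k" "q \<doteq>\<^bsub>K\<^esub> q'"
    using assms unfolding DG_space_def by blast
  then show "\<exists>r\<in>poly_le k. (\<lambda>x. p x + q x) \<doteq>\<^bsub>K\<^esub> r"
    by (intro bexI [of _ "\<lambda>x. p' x + q' x"] eq_on_dom_add poly_le_add)
qed

lemma DG_space_scale:
  assumes "q \<in> DG_space \<Omega> k T"
  shows "(\<lambda>x. c * q x) \<in> DG_space \<Omega> k T"
  unfolding DG_space_def mem_Collect_eq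
proof (intro conjI ballI)
  show "(\<lambda>x. c * q x) \<in> L2 \<Omega>"
    using assms by (intro L2_scale) (simp add: DG_space_def)
next
  fix K assume "K \<in> T"
  then obtain q' where "q' \<in> poly_le k" "q \<doteq>\<^bsub>K\<^esub> q'"
    using assms unfolding DG_space_def by blast
  then show "\<exists>r\<in>poly_le k. (\<lambda>x. c * q x) \<doteq>\<^bsub>K\<^esub> r"
    by (intro bexI [of _ "\<lambda>x. c * q' x"] eq_on_dom_scale poly_le_scale)
qed

text \<open>The elements are compact and finite in number, and their union contains \<open>\<Omega>\<close>.\<close>

lemma triangular_mesh_bounded:
  assumes "triangular_mesh \<Omega> T"
  shows "bounded \<Omega>"
proof -
  have "finite T" "\<And>K. K \<in> T \<Longrightarrow> 2 simplex K" "\<Union>T = closure \<Omega>"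
    using assms by (auto simp: triangular_mesh_def triangulation_def)
  moreover from this have "bounded (\<Union>T)"
    by (intro bounded_Union ballI compact_imp_bounded) (auto intro: compact_simplex)
  ultimately have "bounded (closure \<Omega>)"
    by simp
  then show ?thesis
    using bounded_subset closure_subset by blast
qed

lemma DG_space_const:
  assumes "open \<Omega>" "triangular_mesh \<Omega> T"
  shows "(\<lambda>_. C) \<in> DG_space \<Omega> k T"
proof -
  have "\<Omega> \<in> lmeasurable"
    using assms by (simp add: lmeasurable_open triangular_mesh_bounded)
  moreover have "(\<lambda>_. C) \<doteq>\<^bsub>K\<^esub> (\<lambda>_. C)" for K
    by (simp add: eq_on_dom_def)
  ultimately show ?thesis
    unfolding DG_space_def by (blast intro: L2_const poly_le_const)
qed

lemma transfer_operator_cong: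
  assumes "transfer_operator \<Omega> V W D" "p \<in> V" "q \<in> V" "p \<doteq>\<^bsub>\<Omega>\<^esub> q"
  shows "D p \<doteq>\<^bsub>\<Omega>\<^esub> D q"
  using assms by (simp add: transfer_operator_def)

theorem mainTheorem3:
  fixes \<Omega> :: "(real^2) set"
    and T\<^sub>n T\<^sub>n\<^sub>1 :: "(real^2) set set"
    and k :: nat
    and DGInterp PPDGInterp :: "(real^2 \<Rightarrow> real) \<Rightarrow> (real^2 \<Rightarrow> real)"
    and h m w \<eta> b :: "real^2 \<Rightarrow> real"
    and h' m' w' \<eta>' b' :: "real^2 \<Rightarrow> real"
    and C\<^sub>1 C\<^sub>2 :: real
  defines "V \<equiv> DG_space \<Omega> k T\<^sub>n" and "W \<equiv> DG_space \<Omega> k T\<^sub>n\<^sub>1"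
  assumes domain: "open \<Omega>" "connected \<Omega>" "\<Omega> \<noteq> {}"
    and meshes: "triangular_mesh \<Omega> T\<^sub>n" "triangular_mesh \<Omega> T\<^sub>n\<^sub>1" "same_connectivity T\<^sub>n T\<^sub>n\<^sub>1"
    and degree: "k \<ge> 1"
    and DG: "transfer_operator \<Omega> V W DGInterp"
    and PP: "transfer_operator \<Omega> V W PPDGInterp"
    and DG_const: "\<And>C. DGInterp (\<lambda>_. C) \<doteq>\<^bsub>\<Omega>\<^esub> (\<lambda>_. C)"
    and DG_add: "\<And>p q. p \<in> V \<Longrightarrow> q \<in> V \<Longrightarrow>
      DGInterp (\<lambda>x. p x + q x) \<doteq>\<^bsub>\<Omega>\<^esub> (\<lambda>x. DGInterp p x + DGInterp q x)"
    and DG_scale: "\<And>c q. q \<in> V \<Longrightarrow>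
      DGInterp (\<lambda>x. c * q x) \<doteq>\<^bsub>\<Omega>\<^esub> (\<lambda>x. c * DGInterp q x)"
    and PP_scale: "\<And>C q. C \<ge> 0 \<Longrightarrow> q \<in> V \<Longrightarrow>
      PPDGInterp (\<lambda>x. C * q x) \<doteq>\<^bsub>\<Omega>\<^esub> (\<lambda>x. C * PPDGInterp q x)"
    and data: "h \<in> V" "m \<in> V" "w \<in> V" "\<eta> \<in> V" "b \<in> V"
    and h': "h' \<doteq>\<^bsub>\<Omega>\<^esub> PPDGInterp h"
    and \<eta>': "\<eta>' \<doteq>\<^bsub>\<Omega>\<^esub> PPDGInterp \<eta>"
    and m': "m' \<doteq>\<^bsub>\<Omega>\<^esub> DGInterp m"
    and w': "w' \<doteq>\<^bsub>\<Omega>\<^esub> DGInterp w"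
    and b': "b' \<doteq>\<^bsub>\<Omega>\<^esub> (\<lambda>x. DGInterp (\<lambda>y. h y + b y) x - h' x)"
    and constants: "C\<^sub>1 > 0" "C\<^sub>2 > 0"
    and steady: "m \<doteq>\<^bsub>\<Omega>\<^esub> (\<lambda>_. 0)" "w \<doteq>\<^bsub>\<Omega>\<^esub> (\<lambda>_. 0)"
      "\<eta> \<doteq>\<^bsub>\<Omega>\<^esub> (\<lambda>x. C\<^sub>1 * h x)" "(\<lambda>x. h x + b x) \<doteq>\<^bsub>\<Omega>\<^esub> (\<lambda>_. C\<^sub>2)"
  shows "m' \<doteq>\<^bsub>\<Omega>\<^esub> (\<lambda>_. 0) \<and> w' \<doteq>\<^bsub>\<Omega>\<^esub> (\<lambda>_. 0) \<and>
    \<eta>' \<doteq>\<^bsub>\<Omega>\<^esub> (\<lambda>x. C\<^sub>1 * h' x) \<and> (\<lambda>x. h' x + b' x) \<doteq>\<^bsub>\<Omega>\<^esub> (\<lambda>_. C\<^sub>2)"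
proof -
  have const: "(\<lambda>_. C) \<in> V" for C
    unfolding V_def using domain(1) meshes(1) by (rule DG_space_const)
  have sum: "(\<lambda>x. h x + b x) \<in> V"
    using data unfolding V_def by (intro DG_space_add)
  have scaled: "(\<lambda>x. C\<^sub>1 * h x) \<in> V"
    using data unfolding V_def by (intro DG_space_scale)
  have DG_of_const: "DGInterp q \<doteq>\<^bsub>\<Omega>\<^esub> (\<lambda>_. C)" if "q \<in> V" "q \<doteq>\<^bsub>\<Omega>\<^esub> (\<lambda>_. C)" for q C
    using transfer_operator_cong [OF DG that(1) const that(2)] DG_const
    by (rule eq_on_dom_trans)
  have "m' \<doteq>\<^bsub>\<Omega>\<^esub> (\<lambda>_. 0)"
    using m' DG_of_const [OF data(2) steady(1)] by (rule eq_on_dom_trans)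
  moreover have "w' \<doteq>\<^bsub>\<Omega>\<^esub> (\<lambda>_. 0)"
    using w' DG_of_const [OF data(3) steady(2)] by (rule eq_on_dom_trans)
  moreover have "\<eta>' \<doteq>\<^bsub>\<Omega>\<^esub> (\<lambda>x. C\<^sub>1 * h' x)"
  proof -
    note \<eta>'
    also have "PPDGInterp \<eta> \<doteq>\<^bsub>\<Omega>\<^esub> PPDGInterp (\<lambda>x. C\<^sub>1 * h x)"
      using PP data(4) scaled steady(3) by (rule transfer_operator_cong)
    also have "PPDGInterp (\<lambda>x. C\<^sub>1 * h x) \<doteq>\<^bsub>\<Omega>\<^esub> (\<lambda>x. C\<^sub>1 * PPDGInterp h x)"
      using constants(1) data(1) by (intro PP_scale) simp_all
    also have "(\<lambda>x. C\<^sub>1 * PPDGInterp h x) \<doteq>\<^bsub>\<Omega>\<^esub> (\<lambda>x. C\<^sub>1 * h' x)"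
      by (rule eq_on_dom_scale [OF eq_on_dom_sym [OF h']])
    finally show ?thesis .
  qed
  moreover have "(\<lambda>x. h' x + b' x) \<doteq>\<^bsub>\<Omega>\<^esub> (\<lambda>_. C\<^sub>2)"
  proof -
    have "(\<lambda>x. h' x + b' x) \<doteq>\<^bsub>\<Omega>\<^esub> DGInterp (\<lambda>y. h y + b y)"
      using b' unfolding eq_on_dom_def by (auto elim: eventually_mono)
    then show ?thesis
      using DG_of_const [OF sum steady(4)] by (rule eq_on_dom_trans)
  qed
  ultimately show ?thesis
    by blast
qed

end
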